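(* The quasi-geodesic boundary $\partial_{QG}\mathbb{R}^2$ of the Euclidean plane consists of exactly one point. The same is true of $\mathbb{Z}_+\times\mathbb{Z}_+$, i.e. $\partial_{QG}(\mathbb{Z}_+\times\mathbb{Z}_+)$ consists of exactly one point.
   Context: $Z_+=\mathbb{Z}_+$ is the set of positive integers; $\mathbb{Z}_+\times\mathbb{Z}_+$ carries the metric induced from the plane. For $q\ge 1$, $Q\ge 0$, an integral $(q,Q)$-quasi-geodesic in a metric space $(X,d)$ is a function $g:(a,b)\cap Z_+\to X$ (the interval may be unbounded) with $\frac{|x-y|}{q}-Q\le d(g(x),g(y))\le q|x-y|+Q$ for all $x,y$ in its domain. It originates at $x_0$ if $1$ is in its domain and $g(1)=x_0$; it is a ray if its domain is $Z_+$. For $k\ge 1$, $m\ge 1$ and an integral $(k,k)$-quasi-geodesic ray $g$ with $g(1)=x_0$, the $m$-cone $C_X(x_0,k,k,g,m)$ is the set of all $x\in X$ such that $x=h(i)$ for some $i\ge m$ and some integral $(k,k)$-quasi-geodesic $h$ (possibly with finite domain) with $h(1)=x_0$ and $h(j)=g(j)$ for all $j\le m$. A function $f:X\to\mathbb{C}$ is slowly-oscillating if $|f(x_n)-f(y_n)|\to 0$ whenever $x_n\to\infty$ (i.e. $d(x_0,x_n)\to\infty$) and $d(x_n,y_n)<M$ for all $n$, for some $M>0$. A bounded continuous slowly-oscillating function $f:X\to\mathbb{C}$ is geometrically slowly-oscillating if for every $\epsilon>0$, every $k\ge1$, every $x_0\in X$ and every integral $(k,k)$-quasi-geodesic ray $g$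 in $X$ originating at $x_0$ there is $m\ge 1$ such that the diameter of $f(C_X(x_0,k,k,g,m))$ is smaller than $\epsilon$. $C_{QG}(X)$ is the $C^*$-algebra of all geometrically slowly-oscillating functions on $X$. The quasi-geodesic compactification $X_{QG}$ is the maximal ideal space of $C_{QG}(X)$ (equivalently, the compactification of $X$ such that the functions in $C_{QG}(X)$ are exactly the restrictions to $X$ of continuous functions $X_{QG}\to\mathbb{C}$). For proper $X$, the quasi-geodesic boundary is $\partial_{QG}X:=X_{QG}\setminus X$. *)

theory Defs
  imports "HOL-Analysis.Analysis" "HOL-Algebra.Ideal"
begin

text \<open>
  A metric space is a set \<open>X\<close> in a type of class \<open>metric_space\<close>, with the induced metric.
\<close>

section \<open>Integral quasi-geodesics and cones\<close>

text \<open>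
  The set \<open>(a, b) \<inter> \<int>\<^sub>+\<close>, where \<open>(a, b)\<close> is a possibly unbounded open interval of reals.
\<close>

definition pos_int_interval :: "ereal \<Rightarrow> ereal \<Rightarrow> nat set" where
  "pos_int_interval a b = {n. 1 \<le> n \<and> a < ereal (real n) \<and> ereal (real n) < b}"

text \<open>
  \<open>D\<close> is the domain of the quasi-geodesic; values of \<open>g\<close> outside \<open>D\<close> are irrelevant.
\<close>

definition integral_quasi_geodesic ::
    "'a::metric_space set \<Rightarrow> real \<Rightarrow> real \<Rightarrow> nat set \<Rightarrow> (nat \<Rightarrow> 'a) \<Rightarrow> bool" where
  "integral_quasi_geodesic X q Q D g \<longleftrightarrow>
     1 \<le> q \<and> 0 \<le> Q \<and>
     (\<exists>a b. D = pos_int_interval a b) \<and>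
     g \<in> D \<rightarrow> X \<and>
     (\<forall>x\<in>D. \<forall>y\<in>D.
        \<bar>real x - real y\<bar> / q - Q \<le> dist (g x) (g y) \<and>
        dist (g x) (g y) \<le> q * \<bar>real x - real y\<bar> + Q)"

definition originates_at :: "nat set \<Rightarrow> (nat \<Rightarrow> 'a) \<Rightarrow> 'a \<Rightarrow> bool" where
  "originates_at D g x0 \<longleftrightarrow> 1 \<in> D \<and> g 1 = x0"

definition integral_quasi_geodesic_ray ::
    "'a::metric_space set \<Rightarrow> real \<Rightarrow> real \<Rightarrow> (nat \<Rightarrow> 'a) \<Rightarrow> bool" where
  "integral_quasi_geodesic_ray X q Q g \<longleftrightarrow> integral_quasi_geodesic X q Q {1..} g"

text \<open>
  In the following definition \<open>i \<ge> m\<close> and \<open>i \<in> D\<close>, together with \<open>1 \<in> D\<close>, force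
  \<open>{1..m} \<subseteq> D\<close>, so that \<open>h\<close> and \<open>g\<close> are only compared where both are defined.
\<close>

definition cone ::
    "'a::metric_space set \<Rightarrow> 'a \<Rightarrow> real \<Rightarrow> real \<Rightarrow> (nat \<Rightarrow> 'a) \<Rightarrow> nat \<Rightarrow> 'a set" where
  "cone X x0 q Q g m =
     {x \<in> X. \<exists>D h i. integral_quasi_geodesic X q Q D h \<and> originates_at D h x0 \<and>
                      (\<forall>j\<in>{1..m}. h j = g j) \<and>
                      i \<in> D \<and> m \<le> i \<and> x = h i}"

section \<open>Geometrically slowly-oscillating functions\<close>

definition slowly_oscillating :: "'a::metric_space set \<Rightarrow> ('a \<Rightarrow> complex) \<Rightarrow> bool" where
  "slowly_oscillating X f \<longleftrightarrow>
     (\<forall>x0\<in>X. \<forall>x y M. range x \<subseteq> X \<longrightarrow> range y \<subseteq> X \<longrightarrow>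
        filterlim (\<lambda>n::nat. dist x0 (x n)) at_top sequentially \<longrightarrow>
        0 < M \<longrightarrow> (\<forall>n. dist (x n) (y n) < M) \<longrightarrow>
        (\<lambda>n. norm (f (x n) - f (y n))) \<longlonglongrightarrow> 0)"

definition geometrically_slowly_oscillating ::
    "'a::metric_space set \<Rightarrow> ('a \<Rightarrow> complex) \<Rightarrow> bool" where
  "geometrically_slowly_oscillating X f \<longleftrightarrow>
     bounded (f ` X) \<and> continuous_on X f \<and> slowly_oscillating X f \<and>
     (\<forall>\<epsilon>>0. \<forall>k\<ge>1. \<forall>x0\<in>X. \<forall>g.
        integral_quasi_geodesic_ray X k k g \<longrightarrow> originates_at {1..} g x0 \<longrightarrow>
        (\<exists>m\<ge>1. diameter (f ` cone X x0 k k g m) < \<epsilon>))"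

text \<open>
  Functions on \<open>X\<close> are represented by their extensional representatives, so that functions
  agreeing on \<open>X\<close> are equal.
\<close>

definition C_QG :: "'a::metric_space set \<Rightarrow> ('a \<Rightarrow> complex) set" where
  "C_QG X = {f \<in> extensional X. geometrically_slowly_oscillating X f}"

definition C_QG_ring :: "'a::metric_space set \<Rightarrow> ('a \<Rightarrow> complex) ring" where
  "C_QG_ring X =
     \<lparr>carrier = C_QG X,
      monoid.mult = (\<lambda>f g. \<lambda>x\<in>X. f x * g x),
      one = (\<lambda>x\<in>X. 1),
      zero = (\<lambda>x\<in>X. 0),
      add = (\<lambda>f g. \<lambda>x\<in>X. f x + g x)\<rparr>"

section \<open>The quasi-geodesic compactification and boundary\<close>

text \<open>
  Since \<open>C_QG X\<close> contains the constants, its ideals as a ring are its ideals as a complex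
  algebra. By the Gelfand--Mazur theorem, for every maximal ideal \<open>M\<close> there is exactly one scalar
  \<open>c\<close> with \<open>f - c \<in> M\<close>; this is the value at \<open>M\<close> of the Gelfand transform of \<open>f\<close>.
\<close>

definition gelfand_transform ::
    "'a::metric_space set \<Rightarrow> ('a \<Rightarrow> complex) \<Rightarrow> ('a \<Rightarrow> complex) set \<Rightarrow> complex" where
  "gelfand_transform X f M = (THE c. (\<lambda>x\<in>X. f x - c) \<in> M)"

text \<open>
  The maximal ideal space, with the coarsest topology making all Gelfand transforms continuous.
\<close>

definition quasi_geodesic_compactification ::
    "'a::metric_space set \<Rightarrow> ('a \<Rightarrow> complex) set topology" where
  "quasi_geodesic_compactification X =
     pullback_topology
       {M. maximalideal M (C_QG_ring X)}
       (\<lambda>M. \<lambda>f\<in>C_QG X. gelfand_transform X f M)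
       (product_topology (\<lambda>_. euclidean) (C_QG X))"

lemma topspace_quasi_geodesic_compactification:
  "topspace (quasi_geodesic_compactification X) = {M. maximalideal M (C_QG_ring X)}"
  by (auto simp: quasi_geodesic_compactification_def topspace_pullback_topology)

text \<open>
  In the compactification, a point \<open>x\<close> of \<open>X\<close> is identified with the kernel of evaluation at \<open>x\<close>.
\<close>

definition point_ideal :: "'a::metric_space set \<Rightarrow> 'a \<Rightarrow> ('a \<Rightarrow> complex) set" where
  "point_ideal X x = {f \<in> C_QG X. f x = 0}"

definition quasi_geodesic_boundary ::
    "'a::metric_space set \<Rightarrow> ('a \<Rightarrow> complex) set set" where
  "quasi_geodesic_boundary X =
     topspace (quasi_geodesic_compactification X) - point_ideal X ` X"

section \<open>The lattice quadrant\<close>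

definition pos_int_quadrant :: "(real ^ 2) set" where
  "pos_int_quadrant = {p. \<forall>i. p $ i \<in> \<int> \<and> 0 < p $ i}"

end

theory Submission
  imports Defs
begin

text \<open>
  A function in \<^term>\<open>C_QG X\<close> is nearly constant on every sufficiently deep cone. If, for one
  fixed constant \<open>k\<close> and one fixed ray, each cone already contains everything in \<open>X\<close> outside a
  bounded set, the Cauchy criterion makes every such function converge at infinity. Conversely, on
  a closed set a continuous function with a limit at infinity is geometrically slowly oscillating,
  because the points of a deep cone are far from its origin. So the algebra consists exactly of
  the functions that extend continuously to the one-point compactification of \<open>X\<close>, and its maximal
  ideals are those of the points of \<open>X\<close> and the one of functions vanishing at infinity; the
  boundary is this single ideal (\<open>quasi_geodesic_boundary_singleton\<close>).

  The geometric content is that a multiplicative constant \<open>k\<close> lets quasi-geodesics turn. A path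
  whose steps are bounded and which climbs at unit speed with respect to a Lipschitz height is
  automatically a quasi-geodesic (\<open>integral_quasi_geodesic_by_height\<close>), whatever it does sideways.
  In the plane the height is the norm: while its radius grows from \<open>m\<close> to some \<open>\<rho> \<ge> 2 * m\<close>, a path
  has order \<open>\<rho>\<close> steps in which to move sideways at bounded speed, which suffices to turn through any
  angle (\<open>cones_fill_plane\<close>). In the quadrant the height is the coordinate sum: after following
  the bottom row as far as column \<open>m\<close>, a path may move right, up, or up to the left by \<open>(-1, 2)\<close>,
  and so reach every point of large coordinate sum (\<open>cones_fill_pos_int_quadrant\<close>).
\<close>

section \<open>Convergence at infinity within a set\<close>

definition infinity_in :: "'a::real_normed_vector set \<Rightarrow> 'a filter" where
  "infinity_in X = inf at_infinity (principal X)"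

lemma eventually_infinity_in:
  "eventually P (infinity_in X) \<longleftrightarrow> (\<exists>b. \<forall>x\<in>X. b \<le> norm x \<longrightarrow> P x)"
  unfolding infinity_in_def eventually_inf_principal eventually_at_infinity by blast

lemma infinity_in_neq_bot:
  assumes "\<not> bounded X"
  shows "infinity_in X \<noteq> bot"
proof
  assume "infinity_in X = bot"
  then have "eventually (\<lambda>_. False) (infinity_in X)" by simp
  then obtain b where b: "\<forall>x\<in>X. \<not> b \<le> norm x"
    unfolding eventually_infinity_in by blast
  then have "\<forall>x\<in>X. norm x \<le> b" by force
  with assms show False unfolding bounded_iff by blast
qed

lemma tendsto_infinity_in_cong:
  assumes "\<And>x. x \<in> X \<Longrightarrow> f x = g x"
  shows "(f \<longlongrightarrow> c) (infinity_in X) \<longleftrightarrow> (g \<longlongrightarrow> c) (infinity_in X)"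
  by (rule tendsto_cong) (use assms in \<open>auto simp: eventually_infinity_in\<close>)

text \<open>
  The Cauchy criterion is stated with a set of small oscillation that contains all distant points,
  since cones provide such sets. The limit is found along a sequence escaping to infinity.
\<close>

lemma tendsto_infinity_in_if_Cauchy:
  fixes f :: "'a::real_normed_vector \<Rightarrow> complex"
  assumes "\<not> bounded X"
    and Cauchy: "\<And>\<epsilon>. 0 < \<epsilon> \<Longrightarrow>
      \<exists>S. (\<forall>x\<in>S. \<forall>y\<in>S. dist (f x) (f y) < \<epsilon>) \<and> eventually (\<lambda>x. x \<in> S) (infinity_in X)"
  shows "\<exists>c. (f \<longlongrightarrow> c) (infinity_in X)"
proof -
  have "\<exists>x\<in>X. real n \<le> norm x" for n
    using assms(1) unfolding bounded_iff by (meson nle_le)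
  then obtain p where p: "\<And>n. p n \<in> X" "\<And>n. real n \<le> norm (p n)"
    by metis
  have ev: "\<exists>N. \<forall>n\<ge>N. p n \<in> S" if S: "eventually (\<lambda>x. x \<in> S) (infinity_in X)" for S
  proof -
    obtain b where b: "\<And>x. x \<in> X \<Longrightarrow> b \<le> norm x \<Longrightarrow> x \<in> S"
      using S unfolding eventually_infinity_in by blast
    obtain N where "b \<le> real N" using real_arch_simple by blast
    then have "\<forall>n\<ge>N. p n \<in> S"
      using p b by (meson of_nat_le_iff order_trans)
    then show ?thesis by blast
  qed
  have "Cauchy (\<lambda>n. f (p n))"
    unfolding Cauchy_def
  proof (intro allI impI)
    fix \<epsilon> :: real assume "0 < \<epsilon>"
    then obtain S where S: "\<forall>x\<in>S. \<forall>y\<in>S. dist (f x) (f y) < \<epsilon>"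
      "eventually (\<lambda>x. x \<in> S) (infinity_in X)" using Cauchy by blast
    then show "\<exists>M. \<forall>m\<ge>M. \<forall>n\<ge>M. dist (f (p m)) (f (p n)) < \<epsilon>" using ev[OF S(2)] by blast
  qed
  then obtain c where c: "(\<lambda>n. f (p n)) \<longlonglongrightarrow> c"
    using Cauchy_convergent convergent_def by blast
  have "(f \<longlongrightarrow> c) (infinity_in X)"
  proof (rule tendstoI)
    fix \<epsilon> :: real assume "0 < \<epsilon>"
    then have \<epsilon>2: "0 < \<epsilon> / 2" by simp
    then obtain S where S: "\<forall>x\<in>S. \<forall>y\<in>S. dist (f x) (f y) < \<epsilon> / 2"
      "eventually (\<lambda>x. x \<in> S) (infinity_in X)" using Cauchy by blast
    obtain N where N: "\<forall>n\<ge>N. p n \<in> S" using ev[OF S(2)] by blast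
    obtain N' where N': "\<forall>n\<ge>N'. dist (f (p n)) c < \<epsilon> / 2"
      using c \<epsilon>2 unfolding lim_sequentially by blast
    have "dist (f x) c < \<epsilon>" if "x \<in> S" for x
    proof -
      have "dist (f x) (f (p (max N N'))) < \<epsilon> / 2" using S N that by simp
      moreover have "dist (f (p (max N N'))) c < \<epsilon> / 2" using N' by simp
      ultimately show ?thesis
        using dist_triangle[of "f x" c "f (p (max N N'))"] by simp
    qed
    then show "eventually (\<lambda>x. dist (f x) c < \<epsilon>) (infinity_in X)"
      using S(2) by (rule eventually_mono[rotated])
  qed
  then show ?thesis by blast
qed

section \<open>Functions whose limits are forced by filling cones\<close>

text \<open>
  A single choice of \<open>k\<close>, base point and ray is enough to make all functions of the algebra converge.
  The constant must not depend on \<open>m\<close>, as the cones in the oscillation condition have a fixed \<open>k\<close>.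
  The filling is asked of every \<open>m\<close> because the depth at which the oscillation of a function
  becomes small is not known in advance.
\<close>

definition cones_fill :: "'a::real_normed_vector set \<Rightarrow> 'a \<Rightarrow> real \<Rightarrow> (nat \<Rightarrow> 'a) \<Rightarrow> bool" where
  "cones_fill X x0 k g \<longleftrightarrow>
     x0 \<in> X \<and> 1 \<le> k \<and> integral_quasi_geodesic_ray X k k g \<and> originates_at {1..} g x0 \<and>
     (\<forall>m\<ge>1. eventually (\<lambda>x. x \<in> cone X x0 k k g m) (infinity_in X))"

lemma C_QG_tendsto_infinity:
  assumes "\<not> bounded X" "cones_fill X x0 k g" "f \<in> C_QG X"
  shows "\<exists>c. (f \<longlongrightarrow> c) (infinity_in X)"
proof (rule tendsto_infinity_in_if_Cauchy[OF assms(1)])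
  fix \<epsilon> :: real assume "0 < \<epsilon>"
  have f: "geometrically_slowly_oscillating X f" using assms(3) by (simp add: C_QG_def)
  then obtain m where m: "m \<ge> 1" "diameter (f ` cone X x0 k k g m) < \<epsilon>"
    using \<open>0 < \<epsilon>\<close> assms(2) unfolding geometrically_slowly_oscillating_def cones_fill_def by blast
  have "bounded (f ` cone X x0 k k g m)"
    by (rule bounded_subset[of "f ` X"])
      (use f in \<open>auto simp: geometrically_slowly_oscillating_def cone_def\<close>)
  then have "\<forall>x\<in>cone X x0 k k g m. \<forall>y\<in>cone X x0 k k g m. dist (f x) (f y) < \<epsilon>"
    using m(2) diameter_bounded_bound by (metis (no_types, lifting) image_eqI order_le_less_trans)
  moreover have "eventually (\<lambda>x. x \<in> cone X x0 k k g m) (infinity_in X)"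
    using assms(2) m(1) unfolding cones_fill_def by blast
  ultimately show "\<exists>S. (\<forall>x\<in>S. \<forall>y\<in>S. dist (f x) (f y) < \<epsilon>) \<and>
      eventually (\<lambda>x. x \<in> S) (infinity_in X)" by blast
qed

text \<open>
  Both oscillation conditions compare values at points that are forced to infinity: in the first, a
  point at bounded distance from an escaping one escapes too; in the second, the lower
  quasi-geodesic bound puts the points of the \<open>m\<close>-cone at distance at least \<open>(m - 1) / k - k\<close> from
  the origin of the cone. Closedness makes bounded parts of \<open>X\<close> compact, which gives boundedness
  of \<open>f\<close>.
\<close>

lemma geometrically_slowly_oscillating_if_tendsto_infinity:
  fixes X :: "'a::{real_normed_vector,heine_borel} set"
  assumes "closed X" and cont: "continuous_on X f" and lim: "(f \<longlongrightarrow> c) (infinity_in X)"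
  shows "geometrically_slowly_oscillating X f"
proof -
  have far: "\<exists>b. \<forall>x\<in>X. b \<le> norm x \<longrightarrow> dist (f x) c < \<epsilon>" if "0 < \<epsilon>" for \<epsilon>
    using tendstoD[OF lim that] unfolding eventually_infinity_in .
  have "bounded (f ` X)"
  proof -
    obtain b where b: "\<forall>x\<in>X. b \<le> norm x \<longrightarrow> dist (f x) c < 1" using far[of 1] by auto
    have "compact (f ` (X \<inter> cball 0 b))"
      using assms(1) cont
      by (intro compact_continuous_image closed_Int_compact) (auto intro: continuous_on_subset)
    then have "bounded (f ` (X \<inter> cball 0 b) \<union> cball c 1)" by (simp add: compact_imp_bounded)
    moreover have "f ` X \<subseteq> f ` (X \<inter> cball 0 b) \<union> cball c 1"
    proof
      fix y assume "y \<in> f ` X"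
      then obtain x where "x \<in> X" "y = f x" by blast
      then show "y \<in> f ` (X \<inter> cball 0 b) \<union> cball c 1"
        using b by (cases "b \<le> norm x") (auto simp: dist_commute less_imp_le)
    qed
    ultimately show ?thesis by (rule bounded_subset)
  qed
  moreover have "slowly_oscillating X f"
    unfolding slowly_oscillating_def
  proof (intro ballI allI impI)
    fix x0 M and x y :: "nat \<Rightarrow> 'a"
    assume x: "range x \<subseteq> X" and y: "range y \<subseteq> X"
      and x_inf: "filterlim (\<lambda>n. dist x0 (x n)) at_top sequentially"
      and M: "0 < M" "\<forall>n. dist (x n) (y n) < M"
    have lim': "(\<lambda>n. f (z n)) \<longlonglongrightarrow> c"
      if z: "range z \<subseteq> X" and close: "\<And>n. dist (x n) (z n) < M" for z
    proof (rule tendstoI)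
      fix \<epsilon> :: real assume "0 < \<epsilon>"
      then obtain b where b: "\<forall>x\<in>X. b \<le> norm x \<longrightarrow> dist (f x) c < \<epsilon>" using far by blast
      have "eventually (\<lambda>n. b + norm x0 + M \<le> dist x0 (x n)) sequentially"
        using x_inf unfolding filterlim_at_top by blast
      then show "eventually (\<lambda>n. dist (f (z n)) c < \<epsilon>) sequentially"
      proof (rule eventually_mono)
        fix n assume n: "b + norm x0 + M \<le> dist x0 (x n)"
        have "dist x0 (x n) \<le> norm x0 + norm (z n) + dist (x n) (z n)"
          unfolding dist_norm by norm
        then have "b \<le> norm (z n)" using n close[of n] by linarith
        then show "dist (f (z n)) c < \<epsilon>" using b z by blast
      qed
    qed
    have "(\<lambda>n. f (x n) - f (y n)) \<longlonglongrightarrow> c - c"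
      by (intro tendsto_diff lim') (use x y M in auto)
    then show "(\<lambda>n. norm (f (x n) - f (y n))) \<longlonglongrightarrow> 0"
      using tendsto_norm_zero by simp
  qed
  moreover have "\<exists>m\<ge>1. diameter (f ` cone X x0 k k g m) < \<epsilon>"
    if "0 < \<epsilon>" "1 \<le> k" for \<epsilon> k x0 g
  proof -
    obtain b where b: "\<forall>x\<in>X. b \<le> norm x \<longrightarrow> dist (f x) c < \<epsilon> / 3"
      using far[of "\<epsilon> / 3"] \<open>0 < \<epsilon>\<close> by auto
    \<comment> \<open>The value of \<open>m\<close> that makes \<open>(m - 1) / k - k\<close> at least \<open>b + norm x0\<close>.\<close>
    obtain m :: nat where m: "1 + k * (b + norm x0 + k) \<le> real m" using real_arch_simple by blast
    have near: "dist (f x) c < \<epsilon> / 3" if x: "x \<in> cone X x0 k k g (max 1 m)" for x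
    proof -
      obtain D h i where h: "integral_quasi_geodesic X k k D h" "originates_at D h x0" "i \<in> D"
        "max 1 m \<le> i" "x = h i" and "x \<in> X" using x unfolding cone_def by blast
      have i: "1 \<le> i" "m \<le> i" using h by auto
      have "\<bar>real 1 - real i\<bar> / k - k \<le> dist x0 x"
        using h unfolding integral_quasi_geodesic_def originates_at_def by blast
      moreover have "\<bar>real 1 - real i\<bar> = real i - 1" using i by auto
      ultimately have "(real i - 1) / k - k \<le> dist x0 x" by simp
      moreover have "b + norm x0 + k \<le> (real i - 1) / k"
        using m i \<open>1 \<le> k\<close> by (simp add: field_simps)
      moreover have "dist x0 x \<le> norm x0 + norm x" unfolding dist_norm by norm
      ultimately have "b \<le> norm x" by linarith
      then show ?thesis using b \<open>x \<in> X\<close> by blast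
    qed
    have "diameter (f ` cone X x0 k k g (max 1 m)) \<le> 2 * \<epsilon> / 3"
    proof (rule diameter_le)
      fix u v assume "u \<in> f ` cone X x0 k k g (max 1 m)" "v \<in> f ` cone X x0 k k g (max 1 m)"
      then have "dist u c < \<epsilon> / 3" "dist v c < \<epsilon> / 3" using near by auto
      then show "norm (u - v) \<le> 2 * \<epsilon> / 3"
        using dist_triangle2[of u v c] by (simp add: dist_norm)
    qed (use \<open>0 < \<epsilon>\<close> in auto)
    then show ?thesis using \<open>0 < \<epsilon>\<close> by (intro exI[of _ "max 1 m"]) auto
  qed
  ultimately show ?thesis using cont unfolding geometrically_slowly_oscillating_def by blast
qed

section \<open>Paths of controlled height are quasi-geodesics\<close>

lemma pos_int_interval_atLeastAtMost: "pos_int_interval 0 (ereal (real (Suc n))) = {1..n}"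
  by (auto simp: pos_int_interval_def)

lemma pos_int_interval_atLeast: "pos_int_interval 0 \<infinity> = {1..}"
  by (auto simp: pos_int_interval_def)

text \<open>
  The bounded steps give the upper quasi-geodesic bound. The height gives the lower one: the
  heights at times \<open>i\<close> and \<open>j\<close> differ by at least \<open>\<bar>i - j\<bar> - 2 * c\<close>, and \<open>\<phi>\<close> expands distances
  at most by the factor \<open>k\<close>. The error \<open>2 * c\<close> is divided by \<open>k\<close> as well, hence the bound \<open>k\<^sup>2\<close>.
\<close>

lemma integral_quasi_geodesic_by_height:
  fixes \<phi> :: "'a::metric_space \<Rightarrow> real"
  assumes "1 \<le> k" and D: "D = pos_int_interval a b"
    and X: "\<And>j. j \<in> D \<Longrightarrow> h j \<in> X"
    and lipschitz: "\<And>x y. \<lbrakk>x \<in> X; y \<in> X\<rbrakk> \<Longrightarrow> \<bar>\<phi> x - \<phi> y\<bar> \<le> k * dist x y"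
    and height: "\<And>j. j \<in> D \<Longrightarrow> \<bar>\<phi> (h j) - real j\<bar> \<le> c" and c: "2 * c \<le> k\<^sup>2"
    and step: "\<And>j. \<lbrakk>j \<in> D; Suc j \<in> D\<rbrakk> \<Longrightarrow> dist (h j) (h (Suc j)) \<le> k"
  shows "integral_quasi_geodesic X k k D h"
proof -
  have conv: "j \<in> D" if "i \<in> D" "l \<in> D" "i \<le> j" "j \<le> l" for i j l
  proof -
    have ij: "ereal (real i) \<le> ereal (real j)" "ereal (real j) \<le> ereal (real l)"
      using that by auto
    show ?thesis using that(1,2) order_less_le_trans[OF _ ij(1)] order_le_less_trans[OF ij(2)] that(3)
      unfolding D pos_int_interval_def by auto
  qed
  have chain: "dist (h i) (h (i + n)) \<le> k * real n" if "i \<in> D" "i + n \<in> D" for i n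
    using that(2)
  proof (induction n)
    case (Suc n)
    have n: "i + n \<in> D" by (rule conv[OF that(1) Suc.prems]) auto
    have "dist (h i) (h (i + Suc n)) \<le> dist (h i) (h (i + n)) + dist (h (i + n)) (h (Suc (i + n)))"
      by (simp add: dist_triangle)
    then show ?case using Suc.IH[OF n] step[OF n] Suc.prems by (simp add: algebra_simps)
  qed simp
  have upper: "dist (h x) (h y) \<le> k * \<bar>real x - real y\<bar>" if "x \<in> D" "y \<in> D" for x y
  proof (cases "x \<le> y")
    case True
    then show ?thesis using chain[of x "y - x"] that by simp
  next
    case False
    then show ?thesis using chain[of y "x - y"] that by (simp add: dist_commute)
  qed
  have lower: "\<bar>real x - real y\<bar> / k - k \<le> dist (h x) (h y)" if "x \<in> D" "y \<in> D" for x y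
  proof -
    have "\<bar>real x - real y\<bar> - k\<^sup>2 \<le> k * dist (h x) (h y)"
      using lipschitz[OF X X, OF that] height[OF that(1)] height[OF that(2)] c by linarith
    then show ?thesis using \<open>1 \<le> k\<close> by (simp add: field_simps power2_eq_square)
  qed
  show ?thesis
    unfolding integral_quasi_geodesic_def
  proof (intro conjI ballI)
    show "\<exists>a b. D = pos_int_interval a b" using D by blast
    show "dist (h x) (h y) \<le> k * \<bar>real x - real y\<bar> + k" if "x \<in> D" "y \<in> D" for x y
      using upper[OF that] \<open>1 \<le> k\<close> by linarith
  qed (use X lower \<open>1 \<le> k\<close> in auto)
qed

section \<open>Cones fill the plane\<close>

definition unit_at :: "real \<Rightarrow> real ^ 2" where
  "unit_at t = vector [cos t, sin t]"

lemma norm_unit_at: "norm (unit_at t) = 1"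
  by (simp add: unit_at_def norm_vec_def L2_set_def UNIV_2)

lemma unit_at_lipschitz: "norm (unit_at s - unit_at t) \<le> 2 * \<bar>s - t\<bar>"
proof -
  have half: "\<bar>sin ((s - t) / 2)\<bar> \<le> \<bar>s - t\<bar> / 2" "\<bar>sin ((t - s) / 2)\<bar> \<le> \<bar>s - t\<bar> / 2"
    using abs_sin_x_le_abs_x[of "(s - t) / 2"] abs_sin_x_le_abs_x[of "(t - s) / 2"] by auto
  have "\<bar>cos s - cos t\<bar> \<le> \<bar>s - t\<bar>"
  proof -
    have "\<bar>cos s - cos t\<bar> = 2 * (\<bar>sin ((s + t) / 2)\<bar> * \<bar>sin ((t - s) / 2)\<bar>)"
      by (simp add: cos_diff_cos abs_mult)
    also have "\<dots> \<le> 2 * (1 * (\<bar>s - t\<bar> / 2))"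
      by (intro mult_left_mono mult_mono half) auto
    finally show ?thesis by simp
  qed
  moreover have "\<bar>sin s - sin t\<bar> \<le> \<bar>s - t\<bar>"
  proof -
    have "\<bar>sin s - sin t\<bar> = 2 * (\<bar>sin ((s - t) / 2)\<bar> * \<bar>cos ((s + t) / 2)\<bar>)"
      by (simp add: sin_diff_sin abs_mult)
    also have "\<dots> \<le> 2 * ((\<bar>s - t\<bar> / 2) * 1)"
      by (intro mult_left_mono mult_mono half) auto
    finally show ?thesis by simp
  qed
  ultimately have "\<bar>cos s - cos t\<bar> + \<bar>sin s - sin t\<bar> \<le> \<bar>s - t\<bar> + \<bar>s - t\<bar>"
    by (rule add_mono)
  moreover have "norm (unit_at s - unit_at t) \<le> \<bar>cos s - cos t\<bar> + \<bar>sin s - sin t\<bar>"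
    using norm_le_l1_cart[of "unit_at s - unit_at t"] by (simp add: unit_at_def UNIV_2)
  ultimately show ?thesis by simp
qed

lemma polar_plane:
  fixes x :: "real ^ 2"
  obtains t where "0 \<le> t" "t < 2 * pi" "x = norm x *\<^sub>R unit_at t"
proof (cases "x = 0")
  case True
  then show ?thesis using that[of 0] by simp
next
  case False
  have n: "(norm x)\<^sup>2 = (x $ 1)\<^sup>2 + (x $ 2)\<^sup>2"
    by (simp add: norm_vec_def L2_set_def UNIV_2)
  have "(x $ 1 / norm x)\<^sup>2 + (x $ 2 / norm x)\<^sup>2 = 1"
    using False by (simp add: power_divide add_divide_distrib[symmetric] n[symmetric])
  then obtain t where t: "0 \<le> t" "t < 2 * pi" "x $ 1 / norm x = cos t" "x $ 2 / norm x = sin t"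
    using sincos_total_2pi by blast
  have "x = norm x *\<^sub>R unit_at t"
    using False by (simp add: vec_eq_iff forall_2 unit_at_def t(3,4)[symmetric])
  with t show ?thesis using that by blast
qed

text \<open>
  The ray is the positive first axis. A point at distance \<open>\<rho> \<ge> 2 * m\<close> with polar angle \<open>t\<close> is
  reached at time \<open>i\<close>, about \<open>\<rho> + 1\<close>, by a path of unit radial speed whose angle stays \<open>0\<close> until
  time \<open>m\<close> and then grows linearly to \<open>t\<close>. A step turns by \<open>t / (i - m)\<close>, so it moves sideways by
  a multiple of \<open>t * \<rho> / (i - m)\<close>, and this is bounded since \<open>i - m\<close> is at least half of \<open>\<rho>\<close>. The
  constant \<open>40\<close> is a crude bound for a step.
\<close>

lemma cones_fill_plane: "cones_fill (UNIV :: (real ^ 2) set) 0 40 (\<lambda>j. (real j - 1) *\<^sub>R unit_at 0)"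
  (is "cones_fill _ _ _ ?g")
  unfolding cones_fill_def
proof (intro conjI allI impI)
  have lip: "\<bar>(norm x + 1) - (norm y + 1)\<bar> \<le> 40 * dist x y" for x y :: "real ^ 2"
  proof -
    have "\<bar>norm x - norm y\<bar> \<le> dist x y" unfolding dist_norm by (rule norm_triangle_ineq3)
    then show ?thesis using zero_le_dist[of x y] by simp
  qed
  show "integral_quasi_geodesic_ray UNIV 40 40 ?g"
    unfolding integral_quasi_geodesic_ray_def
  proof (rule integral_quasi_geodesic_by_height[where \<phi> = "\<lambda>x. norm x + 1" and c = 0])
    show "{1..} = pos_int_interval 0 \<infinity>" by (rule pos_int_interval_atLeast[symmetric])
    show "dist (?g j) (?g (Suc j)) \<le> 40" for j
      by (simp add: dist_norm norm_unit_at scaleR_diff_left[symmetric])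
  qed (use lip in \<open>auto simp: norm_unit_at\<close>)
  show "originates_at {1..} ?g 0" by (simp add: originates_at_def)
  fix m :: nat assume "1 \<le> m"
  have "x \<in> cone UNIV 0 40 40 ?g m" if x: "2 * real m \<le> norm x" for x :: "real ^ 2"
  proof -
    obtain t where t: "0 \<le> t" "t < 2 * pi" "x = norm x *\<^sub>R unit_at t" by (rule polar_plane)
    define i where "i = nat \<lceil>norm x\<rceil> + 1"
    have i: "norm x \<le> real i - 1" "real i - 1 < norm x + 1"
      unfolding i_def using norm_ge_zero[of x] by linarith+
    have mi: "2 * real m \<le> real i - 1" using i x by linarith
    \<comment> \<open>The path starts at radius \<open>0\<close> at time \<open>1\<close>; the minimum only shortens
      the last step, so that the path ends exactly at radius \<open>norm x\<close>.\<close>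
    define r where "r j = min (real j - 1) (norm x)" for j
    define \<theta> where "\<theta> j = t * (max 0 (real j - real m) / (real i - real m))" for j
    define h where "h j = r j *\<^sub>R unit_at (\<theta> j)" for j
    have rpos: "0 \<le> r j" if "1 \<le> j" for j using that by (simp add: r_def)
    have turn: "norm x * \<bar>\<theta> j - \<theta> (Suc j)\<bar> \<le> 16" for j
    proof -
      have "\<bar>\<theta> j - \<theta> (Suc j)\<bar> = t * (\<bar>max 0 (real j - real m) - max 0 (real (Suc j) - real m)\<bar> / (real i - real m))"
        unfolding \<theta>_def right_diff_distrib[symmetric] diff_divide_distrib[symmetric] abs_mult abs_divide
        using t(1) mi by simp
      also have "\<dots> \<le> t * (1 / (real i - real m))"
        using t(1) mi by (intro mult_left_mono divide_right_mono) auto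
      also have "\<dots> \<le> 8 / (real i - real m)"
        using t(2) pi_less_4 mi by (simp add: divide_right_mono)
      finally have "norm x * \<bar>\<theta> j - \<theta> (Suc j)\<bar> \<le> norm x * (8 / (real i - real m))"
        by (rule mult_left_mono) simp
      also have "\<dots> \<le> 16" using i mi by (simp add: field_simps)
      finally show ?thesis .
    qed
    have quasi: "integral_quasi_geodesic UNIV 40 40 {1..i} h"
    proof (rule integral_quasi_geodesic_by_height[where \<phi> = "\<lambda>x. norm x + 1" and c = 1])
      show "{1..i} = pos_int_interval 0 (ereal (real (Suc i)))"
        by (rule pos_int_interval_atLeastAtMost[symmetric])
      show "\<bar>norm (h j) + 1 - real j\<bar> \<le> 1" if "j \<in> {1..i}" for j
      proof -
        have "norm (h j) = r j" using that rpos by (simp add: h_def norm_unit_at)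
        moreover have "real j - 1 < norm x + 1" using that i by auto
        ultimately show ?thesis unfolding r_def by (auto simp: min_def)
      qed
      show "dist (h j) (h (Suc j)) \<le> 40" if "j \<in> {1..i}" for j
      proof -
        have "h j - h (Suc j) =
            r j *\<^sub>R (unit_at (\<theta> j) - unit_at (\<theta> (Suc j))) + (r j - r (Suc j)) *\<^sub>R unit_at (\<theta> (Suc j))"
          by (simp add: h_def algebra_simps)
        then have "dist (h j) (h (Suc j)) \<le>
            r j * norm (unit_at (\<theta> j) - unit_at (\<theta> (Suc j))) + \<bar>r j - r (Suc j)\<bar>"
          unfolding dist_norm using that rpos[of j]
          by (metis atLeastAtMost_iff abs_of_nonneg mult.right_neutral norm_scaleR norm_triangle_ineq norm_unit_at)
        also have "\<dots> \<le> norm x * (2 * \<bar>\<theta> j - \<theta> (Suc j)\<bar>) + 1"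
          using rpos[of j] that
          by (intro add_mono mult_mono unit_at_lipschitz) (auto simp: r_def)
        also have "\<dots> \<le> 40" using turn[of j] by simp
        finally show ?thesis .
      qed
    qed (use lip in auto)
    have "h i = x"
    proof -
      have "r i = norm x" "\<theta> i = t" using i mi by (auto simp: r_def \<theta>_def)
      then show ?thesis using t(3) by (simp add: h_def)
    qed
    moreover have "h j = ?g j" if "j \<in> {1..m}" for j
    proof -
      have "real j \<le> real m" using that by simp
      then have "r j = real j - 1" "\<theta> j = 0" using x by (auto simp: r_def \<theta>_def)
      then show ?thesis by (simp add: h_def)
    qed
    moreover have "originates_at {1..i} h 0"
      using i by (auto simp: originates_at_def h_def r_def i_def)
    moreover have "i \<in> {1..i}" "m \<le> i" using mi by (auto simp: i_def)
    ultimately show ?thesis using quasi unfolding cone_def by blast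
  qed
  then show "eventually (\<lambda>x. x \<in> cone UNIV 0 40 40 ?g m) (infinity_in UNIV)"
    unfolding eventually_infinity_in by blast
qed auto

section \<open>Cones fill the lattice quadrant\<close>

text \<open>
  At time \<open>j\<close> the coordinates sum to \<open>j + 1\<close>, so the path is determined by its first coordinate, and
  its steps are bounded as soon as the first coordinate changes by at most one. It may decrease,
  which is what makes the columns to the left of the branch point accessible. A point is reached
  once its coordinate sum is at least \<open>2 * m\<close>.
\<close>

lemma cones_fill_pos_int_quadrant: "cones_fill pos_int_quadrant (vector [1, 1]) 3 (\<lambda>j. vector [real j, 1])"
  (is "cones_fill ?X ?x0 _ ?g")
  unfolding cones_fill_def
proof (intro conjI allI impI)
  let ?\<phi> = "\<lambda>x :: real ^ 2. x $ 1 + x $ 2 - 1"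
  have mem: "vector [real_of_int a, real_of_int b] \<in> ?X \<longleftrightarrow> 0 < a \<and> 0 < b" for a b
    by (simp add: pos_int_quadrant_def forall_2)
  show "?x0 \<in> ?X" using mem[of 1 1] by simp
  have lip: "\<bar>?\<phi> x - ?\<phi> y\<bar> \<le> 3 * dist x y" for x y
  proof -
    have "\<bar>(x - y) $ 1\<bar> \<le> norm (x - y)" "\<bar>(x - y) $ 2\<bar> \<le> norm (x - y)"
      by (rule component_le_norm_cart)+
    then show ?thesis unfolding dist_norm by (simp add: abs_le_iff)
  qed
  show "integral_quasi_geodesic_ray ?X 3 3 ?g"
    unfolding integral_quasi_geodesic_ray_def
  proof (rule integral_quasi_geodesic_by_height[where \<phi> = ?\<phi> and c = 0])
    show "{1..} = pos_int_interval 0 \<infinity>" by (rule pos_int_interval_atLeast[symmetric])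
    show "?g j \<in> ?X" if "j \<in> {1..}" for j using mem[of "int j" 1] that by simp
    show "dist (?g j) (?g (Suc j)) \<le> 3" for j
      using norm_le_l1_cart[of "?g j - ?g (Suc j)"] by (simp add: dist_norm UNIV_2)
  qed (use lip in auto)
  show "originates_at {1..} ?g ?x0" by (simp add: originates_at_def)
  fix m :: nat assume "1 \<le> m"
  have "x \<in> cone ?X ?x0 3 3 ?g m" if "x \<in> ?X" and x: "2 * real m \<le> norm x" for x
  proof -
    have "x $ 1 \<in> \<int>" "x $ 2 \<in> \<int>" "0 < x $ 1" "0 < x $ 2"
      using \<open>x \<in> ?X\<close> by (auto simp: pos_int_quadrant_def)
    then obtain a b where ab: "x $ 1 = real_of_int a" "x $ 2 = real_of_int b" "0 < a" "0 < b"
      by (auto elim!: Ints_cases)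
    have x_ab: "x = vector [real_of_int a, real_of_int b]"
      by (simp add: vec_eq_iff forall_2 ab)
    have "norm x \<le> \<bar>x $ 1\<bar> + \<bar>x $ 2\<bar>" using norm_le_l1_cart[of x] by (simp add: UNIV_2)
    then have "2 * real m \<le> real_of_int (a + b)" using x ab by simp
    then have m: "2 * int m \<le> a + b" by linarith
    define i where "i = nat (a + b - 1)"
    \<comment> \<open>Up to time \<open>m\<close> the first coordinate is \<open>j\<close>; then it moves at unit speed towards
      \<open>a\<close>, decreasing as \<open>2 * m - j\<close> if \<open>a < m\<close>, and stays there.\<close>
    define u where "u j = min (int j) (max a (2 * int m - int j))" for j
    define h where "h j = (vector [real_of_int (u j), real_of_int (int j + 1 - u j)] :: real ^ 2)" for j
    have quasi: "integral_quasi_geodesic ?X 3 3 {1..i} h"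
    proof (rule integral_quasi_geodesic_by_height[where \<phi> = ?\<phi> and c = 0])
      show "{1..i} = pos_int_interval 0 (ereal (real (Suc i)))"
        by (rule pos_int_interval_atLeastAtMost[symmetric])
      show "h j \<in> ?X" if "j \<in> {1..i}" for j
        unfolding h_def mem using that ab by (auto simp: u_def)
      show "dist (h j) (h (Suc j)) \<le> 3" for j
      proof -
        have "\<bar>u j - u (Suc j)\<bar> \<le> 1" unfolding u_def by linarith
        then have "\<bar>real_of_int (u j) - real_of_int (u (Suc j))\<bar> \<le> 1" by linarith
        moreover have "dist (h j) (h (Suc j)) \<le> \<bar>(h j - h (Suc j)) $ 1\<bar> + \<bar>(h j - h (Suc j)) $ 2\<bar>"
          using norm_le_l1_cart[of "h j - h (Suc j)"] by (simp add: dist_norm UNIV_2)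
        ultimately show ?thesis unfolding h_def by simp
      qed
    qed (use lip in \<open>auto simp: h_def\<close>)
    have "h i = x"
    proof -
      have "u i = a" "int i = a + b - 1" using m ab by (auto simp: u_def i_def)
      then show ?thesis using x_ab by (simp add: h_def)
    qed
    moreover have hg: "h j = ?g j" if "j \<in> {1..m}" for j
    proof -
      have "u j = int j" using that by (auto simp: u_def)
      then show ?thesis by (simp add: h_def)
    qed
    moreover have "originates_at {1..i} h ?x0"
      using hg[of 1] \<open>1 \<le> m\<close> ab m by (auto simp: originates_at_def i_def)
    moreover have "i \<in> {1..i}" "m \<le> i" using m \<open>1 \<le> m\<close> by (auto simp: i_def)
    ultimately show ?thesis using quasi \<open>x \<in> ?X\<close> unfolding cone_def by blast
  qed
  then show "eventually (\<lambda>x. x \<in> cone ?X ?x0 3 3 ?g m) (infinity_in ?X)"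
    unfolding eventually_infinity_in by blast
qed auto

lemma closed_pos_int_quadrant: "closed pos_int_quadrant"
proof -
  have "pos_int_quadrant = (\<Inter>i. (\<lambda>p. p $ i) -` (\<int> \<inter> {1..}))"
  proof -
    have "0 < y \<longleftrightarrow> 1 \<le> y" if "y \<in> \<int>" for y :: real
      using that by (auto elim!: Ints_cases)
    then show ?thesis by (auto simp: pos_int_quadrant_def)
  qed
  moreover have "closed ((\<lambda>p :: real ^ 2. p $ i) -` (\<int> \<inter> {1..}))" for i
    by (rule continuous_closed_vimage) (auto intro!: closed_Int closed_Ints continuous_intros)
  ultimately show ?thesis by (metis closed_INT)
qed

lemma unbounded_pos_int_quadrant: "\<not> bounded pos_int_quadrant"
proof
  assume "bounded pos_int_quadrant"
  then obtain B where B: "\<And>p. p \<in> pos_int_quadrant \<Longrightarrow> norm p \<le> B" unfolding bounded_iff by blast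
  obtain n :: nat where n: "B < real n" using reals_Archimedean2 by blast
  let ?p = "vector [real (Suc n), 1] :: real ^ 2"
  have "?p \<in> pos_int_quadrant" by (simp add: pos_int_quadrant_def forall_2)
  then have "\<bar>?p $ 1\<bar> \<le> B" using B component_le_norm_cart order_trans by blast
  then show False using n by simp
qed

section \<open>Maximal ideals of the algebra of functions with a limit at infinity\<close>

text \<open>
  The description of the algebra assumed here is what filling cones provide. It no longer mentions
  quasi-geodesics, so the determination of the maximal ideals is purely topological.
\<close>

locale limit_algebra =
  fixes X :: "'a::{real_normed_vector,heine_borel} set"
  assumes closed_X: "closed X"
    and unbounded_X: "\<not> bounded X"
    and C_QG_iff: "\<And>f. f \<in> C_QG X \<longleftrightarrow>
      f \<in> extensional X \<and> continuous_on X f \<and> (\<exists>c. (f \<longlongrightarrow> c) (infinity_in X))"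
begin

lemma carrier: "carrier (C_QG_ring X) = C_QG X"
  by (simp add: C_QG_ring_def)

lemma restrict_in_C_QG:
  assumes "continuous_on X f" "(f \<longlongrightarrow> c) (infinity_in X)"
  shows "restrict f X \<in> C_QG X"
proof -
  have "continuous_on X (restrict f X)"
    using assms(1) by (rule continuous_on_eq) simp
  moreover have "(restrict f X \<longlongrightarrow> c) (infinity_in X)"
    using assms(2) by (subst tendsto_infinity_in_cong[of _ _ f]) auto
  ultimately show ?thesis unfolding C_QG_iff by auto
qed

lemma C_QG_D:
  assumes "f \<in> C_QG X"
  shows "f \<in> extensional X" "continuous_on X f" "\<exists>c. (f \<longlongrightarrow> c) (infinity_in X)"
  using assms unfolding C_QG_iff by auto

lemma const_in_C_QG: "(\<lambda>x\<in>X. c) \<in> C_QG X"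
  by (rule restrict_in_C_QG) (auto intro: continuous_on_const tendsto_const)

lemma add_in_C_QG:
  assumes "f \<in> C_QG X" "g \<in> C_QG X"
  shows "(\<lambda>x\<in>X. f x + g x) \<in> C_QG X"
  using C_QG_D[OF assms(1)] C_QG_D[OF assms(2)]
  by (auto intro!: restrict_in_C_QG continuous_on_add tendsto_add)

lemma mult_in_C_QG:
  assumes "f \<in> C_QG X" "g \<in> C_QG X"
  shows "(\<lambda>x\<in>X. f x * g x) \<in> C_QG X"
  using C_QG_D[OF assms(1)] C_QG_D[OF assms(2)]
  by (auto intro!: restrict_in_C_QG continuous_on_mult tendsto_mult)

lemma cnj_in_C_QG:
  assumes "f \<in> C_QG X"
  shows "(\<lambda>x\<in>X. cnj (f x)) \<in> C_QG X"
  using C_QG_D[OF assms]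
  by (auto intro!: restrict_in_C_QG continuous_on_cnj tendsto_cnj)

lemma cring: "cring (C_QG_ring X)"
proof (intro cringI abelian_groupI comm_monoidI)
  fix f assume "f \<in> carrier (C_QG_ring X)"
  then have f: "f \<in> C_QG X" by (simp add: carrier)
  have "(\<lambda>x\<in>X. (\<lambda>x\<in>X. - 1) x * f x) \<in> C_QG X"
    by (rule mult_in_C_QG[OF const_in_C_QG f])
  then show "\<exists>g\<in>carrier (C_QG_ring X). g \<oplus>\<^bsub>C_QG_ring X\<^esub> f = \<zero>\<^bsub>C_QG_ring X\<^esub>"
    unfolding carrier by (rule bexI[rotated]) (auto simp: C_QG_ring_def)
qed (auto simp: C_QG_ring_def const_in_C_QG add_in_C_QG mult_in_C_QG algebra_simps
       C_QG_D(1) intro!: extensionalityI[of _ X])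

sublocale cring "C_QG_ring X"
  by (rule cring)

text \<open>
  A character maps onto the field of complex numbers, so its kernel is maximal: an ideal containing
  the kernel and some \<open>f\<close> with \<open>\<phi> f \<noteq> 0\<close> contains \<open>f / \<phi> f\<close> as well as \<open>1 - f / \<phi> f\<close>, hence their
  sum. This treats evaluation at a point and the limit at infinity alike.
\<close>

lemma maximalideal_kernel:
  assumes add: "\<And>f g. \<lbrakk>f \<in> C_QG X; g \<in> C_QG X\<rbrakk> \<Longrightarrow> \<phi> (\<lambda>x\<in>X. f x + g x) = \<phi> f + \<phi> g"
    and mult: "\<And>f g. \<lbrakk>f \<in> C_QG X; g \<in> C_QG X\<rbrakk> \<Longrightarrow> \<phi> (\<lambda>x\<in>X. f x * g x) = \<phi> f * \<phi> g"
    and const: "\<And>c. \<phi> (\<lambda>x\<in>X. c) = (c :: complex)"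
  shows "maximalideal {f \<in> C_QG X. \<phi> f = 0} (C_QG_ring X)"
proof (rule maximalidealI)
  let ?K = "{f \<in> C_QG X. \<phi> f = 0}"
  have ring_add: "f \<oplus>\<^bsub>C_QG_ring X\<^esub> g = (\<lambda>x\<in>X. f x + g x)"
    and ring_mult: "f \<otimes>\<^bsub>C_QG_ring X\<^esub> g = (\<lambda>x\<in>X. f x * g x)"
    and ring_one: "\<one>\<^bsub>C_QG_ring X\<^esub> = (\<lambda>x\<in>X. 1)"
    and ring_zero: "\<zero>\<^bsub>C_QG_ring X\<^esub> = (\<lambda>x\<in>X. 0)" for f g
    by (auto simp: C_QG_ring_def)
  have zero: "(\<lambda>x\<in>X. 0) \<in> ?K" using const[of 0] const_in_C_QG by simp
  show "ideal ?K (C_QG_ring X)"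
  proof (rule idealI)
    show "subgroup ?K (add_monoid (C_QG_ring X))"
    proof (rule add.subgroupI)
      show "?K \<noteq> {}" using zero by blast
      fix f assume f: "f \<in> ?K"
      have "(\<lambda>x\<in>X. (\<lambda>x\<in>X. - 1) x * f x) = \<ominus>\<^bsub>C_QG_ring X\<^esub> f"
        by (rule minus_equality[symmetric])
          (use f mult_in_C_QG[OF const_in_C_QG[of "-1"], of f] in
            \<open>auto simp: carrier ring_add ring_zero fun_eq_iff\<close>)
      moreover have "(\<lambda>x\<in>X. (\<lambda>x\<in>X. - 1) x * f x) \<in> ?K"
        using f mult[OF const_in_C_QG[of "-1"], of f] mult_in_C_QG[OF const_in_C_QG[of "-1"], of f] by auto
      ultimately show "\<ominus>\<^bsub>C_QG_ring X\<^esub> f \<in> ?K" by simp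
    next
      fix f g assume "f \<in> ?K" "g \<in> ?K"
      then show "f \<oplus>\<^bsub>C_QG_ring X\<^esub> g \<in> ?K" by (simp add: ring_add add add_in_C_QG)
    qed (auto simp: carrier)
  qed (auto simp: carrier ring_mult mult mult_in_C_QG ring_axioms)
  have one: "(\<lambda>x\<in>X. 1) \<notin> ?K" using const[of 1] by simp
  then show "carrier (C_QG_ring X) \<noteq> ?K" using const_in_C_QG[of 1] carrier by blast
  fix J assume "ideal J (C_QG_ring X)" and KJ: "?K \<subseteq> J" and "J \<subseteq> carrier (C_QG_ring X)"
  interpret J: ideal J "C_QG_ring X" by fact
  show "J = ?K \<or> J = carrier (C_QG_ring X)"
  proof (rule disjCI)
    assume "J \<noteq> carrier (C_QG_ring X)"
    then have no1: "(\<lambda>x\<in>X. 1) \<notin> J" using J.one_imp_carrier by (auto simp: ring_one)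
    have "\<phi> f = 0" if "f \<in> J" for f
    proof (rule ccontr)
      assume nz: "\<phi> f \<noteq> 0"
      have f: "f \<in> C_QG X" using J.Icarr[OF that] carrier by simp
      define u where "u = (\<lambda>x\<in>X. f x * (\<lambda>x\<in>X. inverse (\<phi> f)) x)"
      have uJ: "u \<in> J"
        using J.I_r_closed[OF that, of "\<lambda>x\<in>X. inverse (\<phi> f)"] const_in_C_QG
        by (simp add: carrier ring_mult u_def)
      have uC: "u \<in> C_QG X" unfolding u_def by (rule mult_in_C_QG[OF f const_in_C_QG])
      define v where "v = (\<lambda>x\<in>X. (\<lambda>x\<in>X. 1) x + (\<lambda>x\<in>X. (\<lambda>x\<in>X. - 1) x * u x) x)"
      have neg: "(\<lambda>x\<in>X. (\<lambda>x\<in>X. - 1) x * u x) \<in> C_QG X" by (rule mult_in_C_QG[OF const_in_C_QG uC])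
      have "\<phi> u = 1"
        unfolding u_def mult[OF f const_in_C_QG] const using nz by simp
      then have "\<phi> v = 0"
        unfolding v_def add[OF const_in_C_QG neg] mult[OF const_in_C_QG uC] const by simp
      moreover have "v \<in> C_QG X" unfolding v_def by (rule add_in_C_QG[OF const_in_C_QG neg])
      ultimately have "v \<in> J" using KJ by blast
      then have "u \<oplus>\<^bsub>C_QG_ring X\<^esub> v \<in> J" using uJ by (simp add: J.a_closed)
      moreover have "u \<oplus>\<^bsub>C_QG_ring X\<^esub> v = (\<lambda>x\<in>X. 1)"
        by (auto simp: ring_add v_def)
      ultimately show False using no1 by simp
    qed
    then show "J = ?K" using KJ J.Icarr carrier by blast
  qed
qed

definition ideal_at_infinity :: "('a \<Rightarrow> complex) set" where
  "ideal_at_infinity = {f \<in> C_QG X. (f \<longlongrightarrow> 0) (infinity_in X)}"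

lemma maximalideal_point_ideal:
  assumes "x \<in> X"
  shows "maximalideal (point_ideal X x) (C_QG_ring X)"
  unfolding point_ideal_def by (rule maximalideal_kernel) (use assms in auto)

lemma Lim_infinity_in: "(f \<longlongrightarrow> c) (infinity_in X) \<Longrightarrow> Lim (infinity_in X) f = c"
  using infinity_in_neq_bot[OF unbounded_X] by (intro tendsto_Lim)

lemma C_QG_tendsto_Lim:
  assumes "f \<in> C_QG X"
  shows "(f \<longlongrightarrow> Lim (infinity_in X) f) (infinity_in X)"
  using C_QG_D(3)[OF assms] Lim_infinity_in by blast

lemma tendsto_restrict:
  "(restrict f X \<longlongrightarrow> c) (infinity_in X) \<longleftrightarrow> (f \<longlongrightarrow> c) (infinity_in X)"
  by (rule tendsto_infinity_in_cong) auto

lemma maximalideal_ideal_at_infinity: "maximalideal ideal_at_infinity (C_QG_ring X)"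
proof -
  have "ideal_at_infinity = {f \<in> C_QG X. Lim (infinity_in X) f = 0}"
    unfolding ideal_at_infinity_def using C_QG_tendsto_Lim Lim_infinity_in by force
  moreover have "maximalideal {f \<in> C_QG X. Lim (infinity_in X) f = 0} (C_QG_ring X)"
    by (rule maximalideal_kernel)
      (auto intro!: Lim_infinity_in tendsto_add tendsto_mult C_QG_tendsto_Lim
            simp: tendsto_restrict)
  ultimately show ?thesis by simp
qed

text \<open>
  The function \<open>1 / (1 + norm y)\<close> tends to \<open>0\<close> at infinity without having a zero.
\<close>

lemma ideal_at_infinity_not_point_ideal:
  assumes "x \<in> X"
  shows "ideal_at_infinity \<noteq> point_ideal X x"
proof -
  let ?f = "\<lambda>y. complex_of_real (inverse (1 + norm y))"
  have "((\<lambda>y. inverse (1 + norm y)) \<longlongrightarrow> 0) (at_infinity :: 'a filter)"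
    by (intro tendsto_inverse_0_at_top filterlim_tendsto_add_at_top[OF tendsto_const]
        filterlim_norm_at_top)
  then have "((\<lambda>y. inverse (1 + norm y)) \<longlongrightarrow> 0) (infinity_in X)"
    unfolding infinity_in_def by (rule tendsto_mono[rotated]) simp
  then have lim: "(?f \<longlongrightarrow> 0) (infinity_in X)"
    by (rule tendsto_of_real[of _ 0, simplified of_real_0])
  have pos: "1 + norm y \<noteq> 0" for y :: 'a using norm_ge_zero[of y] by linarith
  have "restrict ?f X \<in> C_QG X"
    by (rule restrict_in_C_QG[OF _ lim]) (intro continuous_intros pos ballI)
  then have "restrict ?f X \<in> ideal_at_infinity"
    unfolding ideal_at_infinity_def using lim by (simp add: tendsto_restrict)
  moreover have "restrict ?f X \<notin> point_ideal X x"
    using assms pos[of x] by (simp add: point_ideal_def del: of_real_add)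
  ultimately show ?thesis by blast
qed

lemma inverse_in_C_QG:
  assumes "f \<in> C_QG X" "\<And>x. x \<in> X \<Longrightarrow> f x \<noteq> 0" "(f \<longlongrightarrow> c) (infinity_in X)" "c \<noteq> 0"
  shows "(\<lambda>x\<in>X. inverse (f x)) \<in> C_QG X"
  using assms(2-) C_QG_D(2)[OF assms(1)]
  by (auto intro!: restrict_in_C_QG[where c = "inverse c"] continuous_on_inverse tendsto_inverse)

text \<open>
  This is the usual compactness argument on the one-point compactification. A maximal ideal \<open>M\<close>
  that is none of the given ones contains, for every point and for infinity, a function not
  vanishing there. A finite sum of squared absolute values \<open>cnj f * f\<close> of such functions lies in
  \<open>M\<close>, has no zero and a nonzero limit, and is therefore invertible.
\<close>

lemma maximalideal_cases:
  assumes M: "maximalideal M (C_QG_ring X)"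
  shows "M = ideal_at_infinity \<or> (\<exists>x\<in>X. M = point_ideal X x)"
proof (rule ccontr)
  assume not: "\<not> ?thesis"
  interpret M: maximalideal M "C_QG_ring X" by (rule M)
  have not_subset: "\<not> M \<subseteq> N" if "maximalideal N (C_QG_ring X)" "M \<noteq> N" for N
  proof
    assume "M \<subseteq> N"
    interpret N: maximalideal N "C_QG_ring X" by fact
    show False
      using M.I_maximal[OF N.is_ideal \<open>M \<subseteq> N\<close> N.a_subset] N.I_notcarr that(2) by blast
  qed
  have MC: "f \<in> C_QG X" if "f \<in> M" for f using M.Icarr[OF that] carrier by simp
  have M_mult: "(\<lambda>x\<in>X. g x * f x) \<in> M" if "f \<in> M" "g \<in> C_QG X" for f g
    using M.I_l_closed[OF that(1), of g] that(2) by (simp add: carrier) (simp add: C_QG_ring_def)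
  have M_add: "(\<lambda>x\<in>X. f x + g x) \<in> M" if "f \<in> M" "g \<in> M" for f g
    using M.a_closed[OF that] by (simp add: C_QG_ring_def)
  have at_point: "\<exists>f\<in>M. f x \<noteq> 0" if "x \<in> X" for x
    using not_subset[OF maximalideal_point_ideal[OF that]] not that MC
    by (auto simp: point_ideal_def)
  obtain f0 where f0: "f0 \<in> M" "\<not> (f0 \<longlongrightarrow> 0) (infinity_in X)"
    using not_subset[OF maximalideal_ideal_at_infinity] not MC
    by (auto simp: ideal_at_infinity_def)
  obtain c0 where c0: "(f0 \<longlongrightarrow> c0) (infinity_in X)" using C_QG_D(3) MC f0 by blast
  have "c0 \<noteq> 0" using c0 f0 by blast
  then have "eventually (\<lambda>x. f0 x \<noteq> 0) (infinity_in X)"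
    using c0 by (simp add: tendsto_imp_eventually_ne)
  then obtain b where b: "\<And>x. x \<in> X \<Longrightarrow> b \<le> norm x \<Longrightarrow> f0 x \<noteq> 0"
    unfolding eventually_infinity_in by blast
  define sq where "sq f = (\<lambda>x\<in>X. (\<lambda>x\<in>X. cnj (f x)) x * f x)" for f :: "'a \<Rightarrow> complex"
  have sq: "sq f \<in> M" if "f \<in> M" for f
    unfolding sq_def using that MC by (intro M_mult cnj_in_C_QG)
  have sq_apply: "sq f x = of_real ((norm (f x))\<^sup>2)" if "x \<in> X" for f x
    using that by (simp add: sq_def complex_norm_square mult.commute flip: of_real_power)
  obtain T where T: "finite T" "T \<subseteq> M" "\<And>x. x \<in> X \<inter> cball 0 b \<Longrightarrow> \<exists>f\<in>T. f x \<noteq> 0"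
  proof -
    have "compact (X \<inter> cball 0 b)" using closed_X by (simp add: closed_Int_compact)
    moreover have "\<forall>f\<in>M. \<exists>U. open U \<and> U \<inter> X = {x \<in> X. f x \<noteq> 0}"
    proof
      fix f assume "f \<in> M"
      then have "continuous_on X f" using C_QG_D(2) MC by blast
      then obtain U where "open U" "U \<inter> X = f -` (- {0}) \<inter> X"
        unfolding continuous_on_open_invariant by blast
      then show "\<exists>U. open U \<and> U \<inter> X = {x \<in> X. f x \<noteq> 0}" by (intro exI[of _ U]) auto
    qed
    then obtain U where U: "\<And>f. f \<in> M \<Longrightarrow> open (U f)" "\<And>f. f \<in> M \<Longrightarrow> U f \<inter> X = {x \<in> X. f x \<noteq> 0}"
      by metis
    moreover have "X \<inter> cball 0 b \<subseteq> (\<Union>f\<in>M. U f)" using at_point U(2) by blast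
    ultimately obtain T where "T \<subseteq> M" "finite T" "X \<inter> cball 0 b \<subseteq> (\<Union>f\<in>T. U f)"
      by (meson compactE_image)
    then show ?thesis using U(2) by (intro that[of T]) blast+
  qed
  \<comment> \<open>The sum of squares, described only by the lower bounds that it satisfies.\<close>
  have "\<exists>s\<in>M. \<forall>x\<in>X. \<exists>r. s x = of_real r \<and> (norm (f0 x))\<^sup>2 \<le> r \<and> (\<forall>f\<in>T. (norm (f x))\<^sup>2 \<le> r)"
    using T(1,2)
  proof (induction T)
    case empty
    have "\<exists>r. sq f0 x = of_real r \<and> (norm (f0 x))\<^sup>2 \<le> r" if "x \<in> X" for x
      using sq_apply[OF that] by blast
    then show ?case using sq[OF f0(1)] by (intro bexI[of _ "sq f0"]) auto
  next
    case (insert f T)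
    then obtain s where s: "s \<in> M"
      "\<forall>x\<in>X. \<exists>r. s x = of_real r \<and> (norm (f0 x))\<^sup>2 \<le> r \<and> (\<forall>f\<in>T. (norm (f x))\<^sup>2 \<le> r)" by auto
    have "\<exists>r. (\<lambda>x\<in>X. s x + sq f x) x = of_real r \<and> (norm (f0 x))\<^sup>2 \<le> r \<and>
        (\<forall>f\<in>insert f T. (norm (f x))\<^sup>2 \<le> r)" if xX: "x \<in> X" for x
    proof -
      obtain r where r: "s x = of_real r" "(norm (f0 x))\<^sup>2 \<le> r" "\<forall>f\<in>T. (norm (f x))\<^sup>2 \<le> r"
        using bspec[OF s(2) xX] by (elim exE conjE)
      have "0 \<le> r" using r(2) zero_le_power2[of "norm (f0 x)"] by linarith
      then have "(norm (f0 x))\<^sup>2 \<le> r + (norm (f x))\<^sup>2"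
        "\<forall>f'\<in>insert f T. (norm (f' x))\<^sup>2 \<le> r + (norm (f x))\<^sup>2"
        using r(2,3) by (auto intro: add_increasing2)
      moreover have "(\<lambda>x\<in>X. s x + sq f x) x = of_real (r + (norm (f x))\<^sup>2)"
        using xX r(1) sq_apply by simp
      ultimately show ?thesis by blast
    qed
    moreover have "(\<lambda>x\<in>X. s x + sq f x) \<in> M" using s(1) sq insert.prems by (intro M_add) auto
    ultimately show ?case by (intro bexI[of _ "\<lambda>x\<in>X. s x + sq f x"] ballI)
  qed
  then obtain s r where s: "s \<in> M" and r: "\<And>x. x \<in> X \<Longrightarrow> s x = of_real (r x)"
    "\<And>x. x \<in> X \<Longrightarrow> (norm (f0 x))\<^sup>2 \<le> r x" "\<And>x f. x \<in> X \<Longrightarrow> f \<in> T \<Longrightarrow> (norm (f x))\<^sup>2 \<le> r x"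
    by metis
  have s_nz: "s x \<noteq> 0" if "x \<in> X" for x
  proof -
    have "\<exists>z :: complex. z \<noteq> 0 \<and> (norm z)\<^sup>2 \<le> r x"
    proof (cases "b \<le> norm x")
      case True
      then show ?thesis using b r(2) that by blast
    next
      case False
      then have "x \<in> X \<inter> cball 0 b" using that by simp
      then show ?thesis using T(3) r(3) that by blast
    qed
    then have "0 < r x" by (metis order_less_le_trans zero_less_norm_iff zero_less_power)
    then show ?thesis using r(1)[OF that] by simp
  qed
  obtain c where c: "(s \<longlongrightarrow> c) (infinity_in X)" using C_QG_D(3) MC s by blast
  have "c \<noteq> 0"
  proof -
    have "eventually (\<lambda>x. (norm (f0 x))\<^sup>2 \<le> norm (s x)) (infinity_in X)"
      unfolding eventually_infinity_in using r(1,2) by (auto intro: order_trans[OF _ abs_ge_self])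
    then have "(norm c0)\<^sup>2 \<le> norm c"
      by (rule tendsto_le[OF infinity_in_neq_bot[OF unbounded_X] tendsto_norm[OF c]
            tendsto_power[OF tendsto_norm[OF c0]]])
    then show ?thesis using \<open>c0 \<noteq> 0\<close> by auto
  qed
  then have "(\<lambda>x\<in>X. (\<lambda>x\<in>X. inverse (s x)) x * s x) \<in> M"
    using s s_nz c MC by (intro M_mult inverse_in_C_QG)
  moreover have "(\<lambda>x\<in>X. (\<lambda>x\<in>X. inverse (s x)) x * s x) = \<one>\<^bsub>C_QG_ring X\<^esub>"
    using s_nz by (auto simp: C_QG_ring_def fun_eq_iff)
  ultimately show False using M.one_imp_carrier M.I_notcarr by simp
qed

lemma quasi_geodesic_boundary_eq: "quasi_geodesic_boundary X = {ideal_at_infinity}"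
  unfolding quasi_geodesic_boundary_def topspace_quasi_geodesic_compactification
  using maximalideal_cases maximalideal_ideal_at_infinity ideal_at_infinity_not_point_ideal
  by blast

end

text \<open>
  Filling cones identify the algebra with the functions having a limit at infinity.
\<close>

lemma quasi_geodesic_boundary_singleton:
  fixes X :: "'a::{real_normed_vector,heine_borel} set"
  assumes "closed X" "\<not> bounded X" "cones_fill X x0 k g"
  shows "\<exists>\<omega>. quasi_geodesic_boundary X = {\<omega>}"
proof -
  interpret limit_algebra X
  proof
    fix f :: "'a \<Rightarrow> complex"
    show "f \<in> C_QG X \<longleftrightarrow>
        f \<in> extensional X \<and> continuous_on X f \<and> (\<exists>c. (f \<longlongrightarrow> c) (infinity_in X))"
      using C_QG_tendsto_infinity[OF assms(2,3)]
        geometrically_slowly_oscillating_if_tendsto_infinity[OF assms(1)]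
      by (auto simp: C_QG_def geometrically_slowly_oscillating_def)
  qed (use assms in auto)
  show ?thesis using quasi_geodesic_boundary_eq by blast
qed

theorem corollary4p10:
  shows "(\<exists>\<omega>. quasi_geodesic_boundary (UNIV :: (real ^ 2) set) = {\<omega>}) \<and>
         (\<exists>\<omega>. quasi_geodesic_boundary pos_int_quadrant = {\<omega>})"
proof
  show "\<exists>\<omega>. quasi_geodesic_boundary (UNIV :: (real ^ 2) set) = {\<omega>}"
    by (rule quasi_geodesic_boundary_singleton[OF closed_UNIV _ cones_fill_plane]) simp
  show "\<exists>\<omega>. quasi_geodesic_boundary pos_int_quadrant = {\<omega>}"
    by (rule quasi_geodesic_boundary_singleton
        [OF closed_pos_int_quadrant unbounded_pos_int_quadrant cones_fill_pos_int_quadrant])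
qed

end
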